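(* Let $\boldsymbol X=(X_1,\dots,X_d)$ be a real random vector and $\boldsymbol\nu=(\nu_1,\dots,\nu_d)\in\mathbb{N}_0^d$ a multi-index with total order $N=\sum_{j=1}^d\nu_j\ge 1$. Assume $\mathsf{E}[|X_j|^N]<\infty$ for all $j$. Then the joint cumulant $\kappa_{\boldsymbol\nu}(\boldsymbol X)$ satisfies the following. (i) (Raw moments) For any such $\boldsymbol X$, $$|\kappa_{\boldsymbol\nu}(\boldsymbol X)|\le C^{\mathrm{raw}}_N\prod_{j=1}^d\big(\mathsf{E}[|X_j|^N]\big)^{\nu_j/N}.$$ (ii) (Central moments) If $N\ge 2$, then $$|\kappa_{\boldsymbol\nu}(\boldsymbol X)|\le C^{\mathrm{cen}}_N\prod_{j=1}^d\big(\mathsf{E}\big[|X_j-\mathsf{E}[X_j]|^N\big]\big)^{\nu_j/N}.$$ (iii) (Symmetric distributions) If $\boldsymbol X$ and $-\boldsymbol X$ have the same distribution, then $\kappa_{\boldsymbol\nu}(\boldsymbol X)=0$ for odd $N$, while for even $N$ $$|\kappa_{\boldsymbol\nu}(\boldsymbol X)|\le C^{\mathrm{sym}}_N\prod_{j=1}^d\big(\mathsf{E}[|X_j|^N]\big)^{\nu_j/N}.$$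
   Context: $\mathcal{P}(N)$ is the set of all set partitions of $\{1,\dots,N\}$ into nonempty blocks, and $|\pi|$ is the number of blocks of $\pi$. Fix a map $\sigma:\{1,\dots,N\}\to\{1,\dots,d\}$ with $|\sigma^{-1}(j)|=\nu_j$ for each $j$. The joint cumulant is $$\kappa_{\boldsymbol\nu}(\boldsymbol X)=\sum_{\pi\in\mathcal{P}(N)}(-1)^{|\pi|-1}(|\pi|-1)!\prod_{B\in\pi}\mathsf{E}\Big[\prod_{k\in B}X_{\sigma(k)}\Big]$$ (which does not depend on the choice of $\sigma$). The coefficients are $$C^{\mathrm{raw}}_N=\sum_{\pi\in\mathcal{P}(N)}(|\pi|-1)!,\qquad C^{\mathrm{cen}}_N=\sum_{\substack{\pi\in\mathcal{P}(N)\\ |B|\ge2\ \forall B\in\pi}}(|\pi|-1)!,\qquad C^{\mathrm{sym}}_N=\sum_{\substack{\pi\in\mathcal{P}(N)\\ |B|\text{ even }\forall B\in\pi}}(|\pi|-1)!.$$ The convention $0^0=1$ is used (factors with $\nu_j=0$ equal $1$). *)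

theory Defs
  imports "HOL-Probability.Probability"
begin

text \<open>
  A random vector of dimension \<open>d = CARD('d)\<close> is a measurable map into \<open>real ^ 'd\<close>, and
  multi-indices are functions \<open>'d \<Rightarrow> nat\<close>.
\<close>

definition multi_order :: "('d::finite \<Rightarrow> nat) \<Rightarrow> nat" where
  "multi_order \<nu> = (\<Sum>j\<in>UNIV. \<nu> j)"

text \<open>
  A labelling \<open>\<sigma>\<close> of the positions \<open>1, \<dots>, N\<close> by coordinates, using coordinate \<open>j\<close> exactly
  \<open>\<nu> j\<close> times; values of \<open>\<sigma>\<close> outside \<open>{1..N}\<close> are irrelevant.
\<close>

definition index_map :: "('d::finite \<Rightarrow> nat) \<Rightarrow> (nat \<Rightarrow> 'd) \<Rightarrow> bool" where
  "index_map \<nu> \<sigma> \<longleftrightarrow> (\<forall>j. card {k \<in> {1..multi_order \<nu>}. \<sigma> k = j} = \<nu> j)"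

definition set_partitions :: "nat \<Rightarrow> nat set set set" where
  "set_partitions N = {\<pi>. partition_on {1..N} \<pi>}"

text \<open>
  The joint cumulant of order \<open>\<nu>\<close>, written with a labelling \<open>\<sigma>\<close> satisfying \<open>index_map \<nu> \<sigma>\<close>.
  Its value depends on \<open>\<sigma>\<close> only through \<open>\<nu>\<close>, but the labelling is kept as an argument so that
  statements can quantify over all admissible ones.
\<close>

definition joint_cumulant ::
    "'a measure \<Rightarrow> ('d::finite \<Rightarrow> nat) \<Rightarrow> (nat \<Rightarrow> 'd) \<Rightarrow> ('a \<Rightarrow> real ^ 'd) \<Rightarrow> real" where
  "joint_cumulant M \<nu> \<sigma> X =
    (\<Sum>\<pi>\<in>set_partitions (multi_order \<nu>).
      (-1) ^ (card \<pi> - 1) * fact (card \<pi> - 1) *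
      (\<Prod>B\<in>\<pi>. prob_space.expectation M (\<lambda>\<omega>. \<Prod>k\<in>B. X \<omega> $ \<sigma> k)))"

definition C_raw :: "nat \<Rightarrow> real" where
  "C_raw N = (\<Sum>\<pi>\<in>set_partitions N. fact (card \<pi> - 1))"

definition C_cen :: "nat \<Rightarrow> real" where
  "C_cen N = (\<Sum>\<pi>\<in>{\<pi> \<in> set_partitions N. \<forall>B\<in>\<pi>. card B \<ge> 2}. fact (card \<pi> - 1))"

definition C_sym :: "nat \<Rightarrow> real" where
  "C_sym N = (\<Sum>\<pi>\<in>{\<pi> \<in> set_partitions N. \<forall>B\<in>\<pi>. even (card B)}. fact (card \<pi> - 1))"

text \<open>Real powers with the convention that the zeroth power is 1; in the library, \<open>0 powr 0 = 0\<close>.\<close>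

definition rpow :: "real \<Rightarrow> real \<Rightarrow> real" where
  "rpow x a = (if a = 0 then 1 else x powr a)"

lemma index_map_exists: "\<exists>\<sigma>. index_map \<nu> \<sigma>"
proof -
  define S where "S = (SIGMA j:UNIV. {..<\<nu> j})"
  have "finite S" and "card S = multi_order \<nu>"
    by (simp_all add: S_def multi_order_def)
  then obtain g where g: "bij_betw g {1..multi_order \<nu>} S"
    by (metis card_atLeastAtMost diff_Suc_1 finite_atLeastAtMost finite_same_card_bij One_nat_def)
  have "card {k \<in> {1..multi_order \<nu>}. fst (g k) = j} = \<nu> j" for j
  proof -
    let ?K = "{k \<in> {1..multi_order \<nu>}. fst (g k) = j}"
    have "g ` {1..multi_order \<nu>} = S"
      using g by (rule bij_betw_imp_surj_on)
    then have "g ` ?K = {p \<in> S. fst p = j}"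
      by blast
    also have "\<dots> = Pair j ` {..<\<nu> j}"
      unfolding S_def by force
    finally have *: "g ` ?K = Pair j ` {..<\<nu> j}" .
    have "inj_on g ?K"
      by (rule inj_on_subset[OF bij_betw_imp_inj_on[OF g]]) blast
    then have "card ?K = card (g ` ?K)"
      by (rule card_image[symmetric])
    also have "\<dots> = card {..<\<nu> j}"
      unfolding * by (rule card_image) (rule inj_onI, simp)
    finally show ?thesis by simp
  qed
  then show ?thesis
    unfolding index_map_def by (intro exI[of _ "\<lambda>k. fst (g k)"] allI)
qed

end

theory Submission
  imports Defs
begin

text \<open>
  The bounds rest on two facts. First, Hoelder's inequality: with \<open>N\<close> factors in total, the mixed
  moment over a block \<open>B\<close> is at most \<open>\<Prod>k\<in>B. a k\<close>, where \<open>a k\<close> is the norm of the \<open>k\<close>-th factor in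
  \<open>L\<^sup>N\<close> (\<open>Hoelder_mixed_moment\<close>). The blocks of a partition cover each position exactly once, so for
  every partition the product of these bounds is the same number \<open>\<Prod>k\<in>{1..N}. a k\<close>. It factors
  out of the sum, and what is left is the sum of \<open>(\<bar>\<pi>\<bar> - 1)!\<close> over those partitions whose blocks all
  have a nonzero moment (\<open>abs_cumulant_of_moments_le\<close>). With no information on the distribution these
  are all partitions; for a symmetric distribution blocks of odd size drop out, and for odd \<open>N\<close>
  nothing remains, since some block must be odd.

  Secondly, for \<open>N \<ge> 2\<close> the cumulant does not change when the variables are centred
  (\<open>cumulant_translation_invariant\<close>), and for centred variables the singleton blocks drop out.
  Invariance is shown one argument at a time. The cumulant is linear in each argument, so the claim
  is that it vanishes as soon as one argument, say the \<open>i\<close>-th, is constant. A partition of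
  \<open>insert i A\<close> comes from a partition \<open>\<pi>\<close> of \<open>A\<close> either by adding the block \<open>{i}\<close> or by putting
  \<open>i\<close> into one of the \<open>\<bar>\<pi>\<bar>\<close> blocks. All these partitions have the same product of moments, and
  their coefficients cancel:
  \<open>(-1)\<^bsup>\<bar>\<pi>\<bar>\<^esup> \<bar>\<pi>\<bar>! + \<bar>\<pi>\<bar> (-1)\<^bsup>\<bar>\<pi>\<bar>-1\<^esup> (\<bar>\<pi>\<bar> - 1)! = 0\<close>.
\<close>

section \<open>Sums over set partitions\<close>

text \<open>
  A partition of \<open>insert i A\<close> is determined by what it leaves on \<open>A\<close> when \<open>i\<close> is deleted, together
  with the remainder \<open>B\<close> of the block of \<open>i\<close>. Allowing \<open>B = {}\<close> treats the new singleton block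
  \<open>{i}\<close> uniformly with the insertion of \<open>i\<close> into an old block, because a partition never contains
  the empty set.
\<close>

lemma sum_partition_on_insert:
  fixes f :: "'i set set \<Rightarrow> 'b::comm_monoid_add"
  assumes "finite A" "i \<notin> A"
  shows "(\<Sum>\<pi> | partition_on (insert i A) \<pi>. f \<pi>) =
         (\<Sum>\<pi> | partition_on A \<pi>. \<Sum>B\<in>insert {} \<pi>. f (insert (insert i B) (\<pi> - {B})))"
proof -
  let ?D = "SIGMA \<pi>:{\<pi>. partition_on A \<pi>}. insert {} \<pi>"
  let ?h = "\<lambda>(\<pi>, B). insert (insert i B) (\<pi> - {B})"
  \<comment> \<open>The inverse of \<open>?h\<close> deletes \<open>i\<close> from its block and drops that block if nothing remains.\<close>
  let ?g = "\<lambda>\<rho>. let C = (THE C. C \<in> \<rho> \<and> i \<in> C) in ((\<rho> - {C}) \<union> ({C - {i}} - {{}}), C - {i})"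
  have inv: "?g (insert (insert i B) (\<pi> - {B})) = (\<pi>, B)"
    and part: "partition_on (insert i A) (insert (insert i B) (\<pi> - {B}))"
    if \<pi>: "partition_on A \<pi>" and B: "B \<in> insert {} \<pi>" for \<pi> B
  proof -
    have i: "i \<notin> C" if "C \<in> \<pi>" for C
      using partition_onD1[OF \<pi>] that assms by auto
    have BA: "B \<subseteq> A"
      using partition_onD1[OF \<pi>] B by auto
    have ne: "{} \<notin> \<pi>"
      using partition_onD3[OF \<pi>] .
    have the: "(THE C. C \<in> insert (insert i B) (\<pi> - {B}) \<and> i \<in> C) = insert i B"
      using i by (intro the_equality) auto
    have "insert i B - {i} = B"
      using BA assms by auto
    moreover have "insert i B \<notin> \<pi>"
      using i by blast
    ultimately show "?g (insert (insert i B) (\<pi> - {B})) = (\<pi>, B)"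
      unfolding the Let_def using B ne by auto
    have "disjnt (insert i B) (\<Union>(\<pi> - {B}))"
      using \<pi> B i by (auto simp: disjnt_iff partition_on_def pairwise_def)
    moreover have "partition_on (A - B) (\<pi> - {B})"
      using \<pi> B by (auto simp: partition_on_def pairwise_def disjnt_iff)
    moreover have "insert i A - insert i B = A - B"
      using assms by auto
    ultimately show "partition_on (insert i A) (insert (insert i B) (\<pi> - {B}))"
      using BA by (subst partition_on_insert) auto
  qed
  have surj: "\<rho> \<in> ?h ` ?D" if \<rho>: "partition_on (insert i A) \<rho>" for \<rho>
  proof -
    obtain C where C: "C \<in> \<rho>" "i \<in> C"
      using partition_onD1[OF \<rho>] by blast
    have dis: "D \<inter> C = {}" if "D \<in> \<rho>" "D \<noteq> C" for D
      using \<rho> C that by (auto simp: partition_on_def pairwise_def disjnt_iff)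
    have "\<Union>(\<rho> - {C}) = insert i A - C"
      unfolding partition_onD1[OF \<rho>] using dis C by blast
    then have rest: "partition_on (insert i A - C) (\<rho> - {C})"
      using \<rho> by (auto simp: partition_on_def intro: pairwise_subset)
    define \<pi> where "\<pi> = (\<rho> - {C}) \<union> ({C - {i}} - {{}})"
    have CA: "C \<subseteq> insert i A"
      using partition_onD1[OF \<rho>] C by auto
    have "partition_on A \<pi>"
    proof (cases "C = {i}")
      case True
      then show ?thesis using rest assms by (simp add: \<pi>_def)
    next
      case False
      then have "\<pi> = insert (C - {i}) (\<rho> - {C})"
        using C by (auto simp: \<pi>_def)
      moreover have "A - (C - {i}) = insert i A - C"
        using assms C by auto
      moreover have "disjnt (C - {i}) (\<Union>(\<rho> - {C}))"
        using dis by (auto simp: disjnt_iff)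
      moreover have "C - {i} \<subseteq> A" "C - {i} \<noteq> {}"
        using CA C False by auto
      ultimately show ?thesis
        using rest by (simp add: partition_on_insert)
    qed
    moreover have "C - {i} \<in> insert {} \<pi>"
      by (auto simp: \<pi>_def)
    moreover have "\<rho> = insert (insert i (C - {i})) (\<pi> - {C - {i}})"
    proof -
      have "C - {i} \<notin> \<rho> - {C}"
      proof
        assume *: "C - {i} \<in> \<rho> - {C}"
        then have "(C - {i}) \<inter> C = {}"
          by (intro dis) auto
        then have "C - {i} = {}"
          by blast
        then have "{} \<in> \<rho>"
          using * by (simp only: Diff_iff)
        then show False
          using partition_onD3[OF \<rho>] by contradiction
      qed
      then show ?thesis
        using C by (auto simp: \<pi>_def insert_absorb)
    qed
    ultimately show ?thesis
      by (intro image_eqI[of _ _ "(\<pi>, C - {i})"]) auto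
  qed
  have "inj_on ?h ?D"
    by (rule inj_on_inverseI[of _ ?g]) (use inv in auto)
  moreover have "?h ` ?D = {\<rho>. partition_on (insert i A) \<rho>}"
    using part surj by auto
  ultimately have "(\<Sum>\<pi> | partition_on (insert i A) \<pi>. f \<pi>) = (\<Sum>x\<in>?D. f (?h x))"
    by (metis (no_types, lifting) sum.reindex_cong)
  also have "\<dots> = (\<Sum>(\<pi>, B)\<in>?D. f (insert (insert i B) (\<pi> - {B})))"
    by (simp add: case_prod_beta)
  also have "\<dots> = (\<Sum>\<pi> | partition_on A \<pi>. \<Sum>B\<in>insert {} \<pi>. f (insert (insert i B) (\<pi> - {B})))"
    using assms finite_elements[of A]
    by (subst sum.Sigma) (auto simp: finitely_many_partition_on)
  finally show ?thesis .
qed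

section \<open>Cumulants as functions of mixed moments\<close>

text \<open>
  Only the mixed moments enter a cumulant. Taking them as an arbitrary set function \<open>m\<close> separates the
  combinatorics from the probability; the moments of random variables satisfy \<open>m {} = 1\<close>.
\<close>

definition cumulant_of_moments :: "'i set \<Rightarrow> ('i set \<Rightarrow> real) \<Rightarrow> real" where
  "cumulant_of_moments A m =
    (\<Sum>\<pi> | partition_on A \<pi>. (-1) ^ (card \<pi> - 1) * fact (card \<pi> - 1) * (\<Prod>B\<in>\<pi>. m B))"

lemma cumulant_of_moments_cong:
  assumes "\<And>B. B \<subseteq> A \<Longrightarrow> m B = m' B"
  shows "cumulant_of_moments A m = cumulant_of_moments A m'"
  unfolding cumulant_of_moments_def
proof (intro sum.cong refl)
  fix \<pi> assume "\<pi> \<in> {\<pi>. partition_on A \<pi>}"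
  then have "(\<Prod>B\<in>\<pi>. m B) = (\<Prod>B\<in>\<pi>. m' B)"
    by (intro prod.cong refl assms) (auto simp: partition_on_def)
  then show "(-1) ^ (card \<pi> - 1) * fact (card \<pi> - 1) * (\<Prod>B\<in>\<pi>. m B) =
      (-1) ^ (card \<pi> - 1) * fact (card \<pi> - 1) * (\<Prod>B\<in>\<pi>. m' B)"
    by simp
qed

text \<open>
  A bound on moments that is multiplicative over the positions takes the same value on every
  partition, so only the coefficients remain to be summed. The predicate \<open>P\<close> selects the blocks that
  can contribute; a partition with any other block has a zero factor.
\<close>

lemma abs_cumulant_of_moments_le:
  fixes a :: "'i \<Rightarrow> real"
  assumes "finite A"
    and bound: "\<And>B. B \<subseteq> A \<Longrightarrow> \<bar>m B\<bar> \<le> (\<Prod>k\<in>B. a k)"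
    and vanish: "\<And>B. B \<subseteq> A \<Longrightarrow> B \<noteq> {} \<Longrightarrow> \<not> P B \<Longrightarrow> m B = 0"
  shows "\<bar>cumulant_of_moments A m\<bar> \<le>
    (\<Sum>\<pi> | partition_on A \<pi> \<and> (\<forall>B\<in>\<pi>. P B). fact (card \<pi> - 1)) * (\<Prod>k\<in>A. a k)"
proof -
  have fin: "finite {\<pi>. partition_on A \<pi>}"
    using assms(1) by (rule finitely_many_partition_on)
  have blk: "B \<subseteq> A" "B \<noteq> {}" if "partition_on A \<pi>" "B \<in> \<pi>" for \<pi> B
    using that by (auto simp: partition_on_def)
  have "cumulant_of_moments A m =
      (\<Sum>\<pi> | partition_on A \<pi> \<and> (\<forall>B\<in>\<pi>. P B).
        (-1) ^ (card \<pi> - 1) * fact (card \<pi> - 1) * (\<Prod>B\<in>\<pi>. m B))"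
    unfolding cumulant_of_moments_def
  proof (intro sum.mono_neutral_right[OF fin] ballI)
    show "{\<pi>. partition_on A \<pi> \<and> (\<forall>B\<in>\<pi>. P B)} \<subseteq> {\<pi>. partition_on A \<pi>}"
      by auto
  next
    fix \<pi> assume "\<pi> \<in> {\<pi>. partition_on A \<pi>} - {\<pi>. partition_on A \<pi> \<and> (\<forall>B\<in>\<pi>. P B)}"
    then obtain B where \<pi>: "partition_on A \<pi>" and B: "B \<in> \<pi>" "\<not> P B"
      by auto
    then have "\<exists>B\<in>\<pi>. m B = 0"
      using vanish[OF blk[OF \<pi> B(1)] B(2)] by auto
    then have "(\<Prod>B\<in>\<pi>. m B) = 0"
      using finite_elements[OF assms(1) \<pi>] by (simp add: prod_zero)
    then show "(-1) ^ (card \<pi> - 1) * fact (card \<pi> - 1) * (\<Prod>B\<in>\<pi>. m B) = 0"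
      by simp
  qed
  also have "\<bar>\<dots>\<bar> \<le>
      (\<Sum>\<pi> | partition_on A \<pi> \<and> (\<forall>B\<in>\<pi>. P B).
        \<bar>(-1) ^ (card \<pi> - 1) * fact (card \<pi> - 1) * (\<Prod>B\<in>\<pi>. m B)\<bar>)"
    by (rule sum_abs)
  also have "\<dots> \<le> (\<Sum>\<pi> | partition_on A \<pi> \<and> (\<forall>B\<in>\<pi>. P B). fact (card \<pi> - 1) * (\<Prod>k\<in>A. a k))"
  proof (intro sum_mono)
    fix \<pi> assume "\<pi> \<in> {\<pi>. partition_on A \<pi> \<and> (\<forall>B\<in>\<pi>. P B)}"
    then have \<pi>: "partition_on A \<pi>" by simp
    have "\<bar>\<Prod>B\<in>\<pi>. m B\<bar> \<le> (\<Prod>B\<in>\<pi>. \<Prod>k\<in>B. a k)"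
      unfolding abs_prod using bound blk[OF \<pi>] by (intro prod_mono) auto
    also have "\<dots> = (\<Prod>k\<in>A. a k)"
      using prod.partition[OF assms(1) \<pi>] by metis
    finally show "\<bar>(-1) ^ (card \<pi> - 1) * fact (card \<pi> - 1) * (\<Prod>B\<in>\<pi>. m B)\<bar> \<le>
        fact (card \<pi> - 1) * (\<Prod>k\<in>A. a k)"
      by (simp add: abs_mult power_abs mult_left_mono)
  qed
  finally show ?thesis
    by (simp add: sum_distrib_right)
qed

text \<open>
  \<open>m (B - {i})\<close> is the mixed moment over \<open>B\<close> when the \<open>i\<close>-th variable is the constant 1. Hence this
  says that a cumulant of order at least two vanishes if one of its arguments is constant.
\<close>

lemma cumulant_of_moments_unit_argument:
  assumes "finite A" "i \<notin> A" "A \<noteq> {}" "m {} = 1"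
  shows "cumulant_of_moments (insert i A) (\<lambda>B. m (B - {i})) = 0"
proof -
  let ?c = "\<lambda>n::nat. (-1) ^ (n - 1) * fact (n - 1) :: real"
  have inner: "(\<Sum>B\<in>insert {} \<pi>. ?c (card (insert (insert i B) (\<pi> - {B}))) *
      (\<Prod>C\<in>insert (insert i B) (\<pi> - {B}). m (C - {i}))) = 0"
    if \<pi>: "partition_on A \<pi>" for \<pi>
  proof -
    have fin: "finite \<pi>"
      using finite_elements[OF assms(1) \<pi>] .
    have ne: "{} \<notin> \<pi>"
      using partition_onD3[OF \<pi>] .
    have i: "i \<notin> C" if "C \<in> insert {} \<pi>" for C
      using partition_onD1[OF \<pi>] that assms by auto
    have "\<pi> \<noteq> {}"
      using partition_onD1[OF \<pi>] assms by auto
    then obtain n where n: "card \<pi> = Suc n"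
      using fin by (metis card_eq_0_iff not0_implies_Suc)
    have new: "insert i B \<notin> \<pi> - {B}" for B
      using i by blast
    have prod: "(\<Prod>C\<in>insert (insert i B) (\<pi> - {B}). m (C - {i})) = (\<Prod>C\<in>\<pi>. m C)"
      if B: "B \<in> insert {} \<pi>" for B
    proof -
      have "(\<Prod>C\<in>insert (insert i B) (\<pi> - {B}). m (C - {i})) =
          m (insert i B - {i}) * (\<Prod>C\<in>\<pi> - {B}. m (C - {i}))"
        using fin new by simp
      also have "(\<Prod>C\<in>\<pi> - {B}. m (C - {i})) = (\<Prod>C\<in>\<pi> - {B}. m C)"
        using i by (intro prod.cong) auto
      also have "insert i B - {i} = B"
        using i[OF B] by simp
      also have "m B * (\<Prod>C\<in>\<pi> - {B}. m C) = (\<Prod>C\<in>\<pi>. m C)"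
        using B ne fin assms(4) by (cases "B = {}") (auto simp: prod.remove)
      finally show ?thesis .
    qed
    \<comment> \<open>Only the choice \<open>B = {}\<close>, which creates the block \<open>{i}\<close>, increases the number of blocks.\<close>
    have card: "card (insert (insert i B) (\<pi> - {B})) = (if B = {} then Suc (card \<pi>) else card \<pi>)"
      if B: "B \<in> insert {} \<pi>" for B
      using B ne fin new[of B] n by (auto simp: card_insert_if card_Diff_singleton_if)
    have "(\<Sum>B\<in>insert {} \<pi>. ?c (card (insert (insert i B) (\<pi> - {B}))) *
        (\<Prod>C\<in>insert (insert i B) (\<pi> - {B}). m (C - {i}))) =
        (\<Sum>B\<in>insert {} \<pi>. ?c (if B = {} then Suc (card \<pi>) else card \<pi>) * (\<Prod>C\<in>\<pi>. m C))"
      by (intro sum.cong refl) (simp only: card prod)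
    also have "\<dots> = ?c (Suc (card \<pi>)) * (\<Prod>C\<in>\<pi>. m C) +
        (\<Sum>B\<in>\<pi>. ?c (if B = {} then Suc (card \<pi>) else card \<pi>) * (\<Prod>C\<in>\<pi>. m C))"
      using fin ne by simp
    also have "(\<Sum>B\<in>\<pi>. ?c (if B = {} then Suc (card \<pi>) else card \<pi>) * (\<Prod>C\<in>\<pi>. m C)) =
        (\<Sum>B\<in>\<pi>. ?c (card \<pi>) * (\<Prod>C\<in>\<pi>. m C))"
      using ne by (intro sum.cong refl) auto
    also have "?c (Suc (card \<pi>)) * (\<Prod>C\<in>\<pi>. m C) + \<dots> = 0"
      by (simp add: n algebra_simps)
    finally show ?thesis .
  qed
  show ?thesis
    unfolding cumulant_of_moments_def sum_partition_on_insert[OF assms(1,2)]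
    using inner by (intro sum.neutral) blast
qed

text \<open>
  The set function on the left is the moment function after \<open>c\<close> has been subtracted from the \<open>i\<close>-th
  variable. As \<open>i\<close> lies in exactly one block, every product over a partition is affine in \<open>c\<close>, and
  the coefficients of \<open>c\<close> add up to minus the cumulant with \<open>i\<close>-th argument 1, which is 0.
\<close>

lemma cumulant_of_moments_shift:
  assumes "finite A" "i \<in> A" "A \<noteq> {i}" "m {} = 1"
  shows "cumulant_of_moments A (\<lambda>B. if i \<in> B then m B - c * m (B - {i}) else m B) =
         cumulant_of_moments A m"
proof -
  let ?m = "\<lambda>B. if i \<in> B then m B - c * m (B - {i}) else m B"
  have prod: "(\<Prod>B\<in>\<pi>. ?m B) = (\<Prod>B\<in>\<pi>. m B) - c * (\<Prod>B\<in>\<pi>. m (B - {i}))"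
    if \<pi>: "partition_on A \<pi>" for \<pi>
  proof -
    have fin: "finite \<pi>"
      using finite_elements[OF assms(1) \<pi>] .
    obtain C where C: "C \<in> \<pi>" "i \<in> C"
      using partition_onD1[OF \<pi>] assms by blast
    have i: "i \<notin> D" if "D \<in> \<pi> - {C}" for D
      using \<pi> C that by (auto simp: partition_on_def pairwise_def disjnt_iff)
    have "(\<Prod>B\<in>\<pi>. ?m B) = (m C - c * m (C - {i})) * (\<Prod>B\<in>\<pi> - {C}. ?m B)"
      using C fin by (simp add: prod.remove)
    also have "(\<Prod>B\<in>\<pi> - {C}. ?m B) = (\<Prod>B\<in>\<pi> - {C}. m B)"
      using i by (intro prod.cong) auto
    also have "(m C - c * m (C - {i})) * \<dots> =
        m C * (\<Prod>B\<in>\<pi> - {C}. m B) - c * (m (C - {i}) * (\<Prod>B\<in>\<pi> - {C}. m B))"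
      by (simp add: algebra_simps)
    also have "m C * (\<Prod>B\<in>\<pi> - {C}. m B) = (\<Prod>B\<in>\<pi>. m B)"
      using C fin by (simp add: prod.remove)
    also have "(\<Prod>B\<in>\<pi> - {C}. m B) = (\<Prod>B\<in>\<pi> - {C}. m (B - {i}))"
      using i by (intro prod.cong) auto
    also have "m (C - {i}) * \<dots> = (\<Prod>B\<in>\<pi>. m (B - {i}))"
      using prod.remove[OF fin C(1), of "\<lambda>B. m (B - {i})"] by simp
    finally show ?thesis .
  qed
  have "cumulant_of_moments A ?m =
      cumulant_of_moments A m - c * cumulant_of_moments A (\<lambda>B. m (B - {i}))"
    unfolding cumulant_of_moments_def sum_distrib_left sum_subtractf[symmetric]
  proof (rule sum.cong[OF refl])
    fix \<pi> assume "\<pi> \<in> {\<pi>. partition_on A \<pi>}"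
    then have "partition_on A \<pi>" by simp
    note prod = prod[OF this]
    show "(-1) ^ (card \<pi> - 1) * fact (card \<pi> - 1) * (\<Prod>B\<in>\<pi>. ?m B) =
      (-1) ^ (card \<pi> - 1) * fact (card \<pi> - 1) * (\<Prod>B\<in>\<pi>. m B) -
      c * ((-1) ^ (card \<pi> - 1) * fact (card \<pi> - 1) * (\<Prod>B\<in>\<pi>. m (B - {i})))"
      unfolding prod by (simp only: right_diff_distrib mult.left_commute)
  qed
  also have "cumulant_of_moments A (\<lambda>B. m (B - {i})) = 0"
  proof -
    have "A = insert i (A - {i})" "A - {i} \<noteq> {}"
      using assms by auto
    then show ?thesis
      using cumulant_of_moments_unit_argument[of "A - {i}" i m] assms by auto
  qed
  finally show ?thesis by simp
qed

section \<open>Hoelder's inequality for mixed moments\<close>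

text \<open>
  The inequality of arithmetic and geometric means for the \<open>card A\<close> numbers \<open>z k ^ card A\<close>, where the
  places outside \<open>B\<close> are filled with ones. The padding lets one exponent, \<open>card A\<close>, serve all blocks.
\<close>

lemma prod_le_mean_of_powers:
  fixes z :: "'i \<Rightarrow> real"
  assumes "finite A" "A \<noteq> {}" "B \<subseteq> A" "\<And>k. k \<in> B \<Longrightarrow> 0 \<le> z k"
  shows "(\<Prod>k\<in>B. z k) \<le> (\<Sum>k\<in>A. (if k \<in> B then z k ^ card A else 1) / card A)"
proof -
  let ?x = "\<lambda>k. if k \<in> B then z k ^ card A else 1"
  have pos: "0 \<le> (\<Prod>k\<in>B. z k)"
    using assms by (intro prod_nonneg) auto
  have N: "card A > 0"
    using assms by (simp add: card_gt_0_iff)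
  have "(\<Prod>k\<in>A. ?x k) = (\<Prod>k\<in>B. z k ^ card A)"
    using assms by (subst prod.inter_restrict[symmetric]) (auto simp: Int_absorb1)
  also have "\<dots> = (\<Prod>k\<in>B. z k) ^ card A"
    by (simp add: prod_power_distrib)
  finally have "(\<Prod>k\<in>A. ?x k) = (\<Prod>k\<in>B. z k) ^ card A" .
  moreover have "(p ^ card A) powr (1 / card A) = p" if "0 \<le> p" for p :: real
    using that N by (cases "p = 0") (simp_all add: powr_realpow[symmetric] powr_powr)
  ultimately have "(\<Prod>k\<in>A. ?x k) powr (1 / card A) = (\<Prod>k\<in>B. z k)"
    using pos by simp
  then show ?thesis
    using arith_geom_mean[of A ?x] assms by auto
qed

lemma integrable_prod_of_integrable_power:
  fixes Y :: "'i \<Rightarrow> 'a \<Rightarrow> real"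
  assumes "prob_space M" "finite A" "A \<noteq> {}" "B \<subseteq> A"
    and meas: "\<And>k. k \<in> A \<Longrightarrow> Y k \<in> borel_measurable M"
    and int: "\<And>k. k \<in> A \<Longrightarrow> integrable M (\<lambda>\<omega>. \<bar>Y k \<omega>\<bar> ^ card A)"
  shows "integrable M (\<lambda>\<omega>. \<Prod>k\<in>B. Y k \<omega>)"
proof -
  interpret prob_space M by fact
  show ?thesis
  proof (rule Bochner_Integration.integrable_bound)
    show "integrable M (\<lambda>\<omega>. \<Sum>k\<in>A. (if k \<in> B then \<bar>Y k \<omega>\<bar> ^ card A else 1) / card A)"
    proof (intro Bochner_Integration.integrable_sum)
      fix k assume "k \<in> A"
      then show "integrable M (\<lambda>\<omega>. (if k \<in> B then \<bar>Y k \<omega>\<bar> ^ card A else 1) / card A)"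
        using int by (cases "k \<in> B") auto
    qed
    show "(\<lambda>\<omega>. \<Prod>k\<in>B. Y k \<omega>) \<in> borel_measurable M"
      using meas assms(4) by (intro borel_measurable_prod) auto
    show "AE \<omega> in M. norm (\<Prod>k\<in>B. Y k \<omega>)
        \<le> norm (\<Sum>k\<in>A. (if k \<in> B then \<bar>Y k \<omega>\<bar> ^ card A else 1) / card A)"
    proof (rule AE_I2)
      fix \<omega>
      show "norm (\<Prod>k\<in>B. Y k \<omega>)
        \<le> norm (\<Sum>k\<in>A. (if k \<in> B then \<bar>Y k \<omega>\<bar> ^ card A else 1) / card A)"
        using prod_le_mean_of_powers[OF assms(2-4), of "\<lambda>k. \<bar>Y k \<omega>\<bar>"]
        by (simp add: abs_prod)
    qed
  qed
qed

text \<open>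
  If some variable has norm 0 in \<open>L\<^sup>N\<close>, it vanishes almost everywhere, and so does the product.
  Otherwise every variable can be scaled to norm 1; the expectation of the pointwise bound
  \<open>prod_le_mean_of_powers\<close> is then a mean of ones. Since \<open>M\<close> has mass 1, \<open>B\<close> may be smaller than
  \<open>A\<close> although the exponent is \<open>card A\<close>.
\<close>

lemma Hoelder_mixed_moment:
  fixes Y :: "'i \<Rightarrow> 'a \<Rightarrow> real"
  assumes "prob_space M" "finite A" "A \<noteq> {}" "B \<subseteq> A"
    and meas: "\<And>k. k \<in> A \<Longrightarrow> Y k \<in> borel_measurable M"
    and int: "\<And>k. k \<in> A \<Longrightarrow> integrable M (\<lambda>\<omega>. \<bar>Y k \<omega>\<bar> ^ card A)"
  shows "\<bar>integral\<^sup>L M (\<lambda>\<omega>. \<Prod>k\<in>B. Y k \<omega>)\<bar> \<le>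
    (\<Prod>k\<in>B. integral\<^sup>L M (\<lambda>\<omega>. \<bar>Y k \<omega>\<bar> ^ card A) powr (1 / card A))"
proof -
  interpret prob_space M by fact
  define n where "n k = integral\<^sup>L M (\<lambda>\<omega>. \<bar>Y k \<omega>\<bar> ^ card A)" for k
  define a where "a k = n k powr (1 / card A)" for k
  have finB: "finite B"
    using assms finite_subset by blast
  have N: "card A > 0"
    using assms by (simp add: card_gt_0_iff)
  have n0: "0 \<le> n k" for k
    unfolding n_def by simp
  have a0: "0 \<le> a k" for k
    by (simp add: a_def)
  have aN: "a k ^ card A = n k" for k
    using N n0[of k] by (cases "n k = 0") (simp_all add: a_def powr_power)
  show ?thesis
  proof (cases "\<exists>k\<in>B. a k = 0")
    case True
    then obtain k where k: "k \<in> B" "n k = 0"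
      using aN N by (metis power_eq_0_iff)
    then have "AE \<omega> in M. \<bar>Y k \<omega>\<bar> ^ card A = 0"
      using int assms(4)
      by (subst integral_nonneg_eq_0_iff_AE[symmetric]) (auto simp: n_def)
    then have "AE \<omega> in M. (\<Prod>k\<in>B. Y k \<omega>) = 0"
    proof eventually_elim
      case (elim \<omega>)
      then have "Y k \<omega> = 0" by simp
      then show ?case using k finB by (intro prod_zero) auto
    qed
    then have "integral\<^sup>L M (\<lambda>\<omega>. \<Prod>k\<in>B. Y k \<omega>) = 0"
      by (rule integral_eq_zero_AE)
    then show ?thesis
      by (simp add: prod_nonneg)
  next
    case False
    then have apos: "0 < a k" if "k \<in> B" for k
      using a0[of k] that by fastforce
    let ?Z = "\<lambda>k \<omega>. \<bar>Y k \<omega>\<bar> / a k"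
    have Zint: "integrable M (\<lambda>\<omega>. \<Prod>k\<in>B. Y k \<omega> / a k)"
      using integrable_prod_of_integrable_power[OF assms] 
      by (simp add: prod_dividef)
    have powint: "integrable M (\<lambda>\<omega>. (if k \<in> B then ?Z k \<omega> ^ card A else 1) / card A)"
      if "k \<in> A" for k
      using int[OF that] by (cases "k \<in> B") (auto simp: power_divide)
    have "\<bar>integral\<^sup>L M (\<lambda>\<omega>. \<Prod>k\<in>B. Y k \<omega> / a k)\<bar> \<le> integral\<^sup>L M (\<lambda>\<omega>. \<Prod>k\<in>B. ?Z k \<omega>)"
      using integral_abs_bound[of M "\<lambda>\<omega>. \<Prod>k\<in>B. Y k \<omega> / a k"] a0 by (simp add: abs_prod)
    also have "\<dots> \<le> integral\<^sup>L M (\<lambda>\<omega>. \<Sum>k\<in>A. (if k \<in> B then ?Z k \<omega> ^ card A else 1) / card A)"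
    proof (rule integral_mono)
      show "integrable M (\<lambda>\<omega>. \<Prod>k\<in>B. ?Z k \<omega>)"
        using integrable_abs[OF Zint] a0 by (simp add: abs_prod)
      show "integrable M (\<lambda>\<omega>. \<Sum>k\<in>A. (if k \<in> B then ?Z k \<omega> ^ card A else 1) / card A)"
        using powint by (rule Bochner_Integration.integrable_sum)
      show "(\<Prod>k\<in>B. ?Z k \<omega>) \<le> (\<Sum>k\<in>A. (if k \<in> B then ?Z k \<omega> ^ card A else 1) / card A)" for \<omega>
        using a0 by (intro prod_le_mean_of_powers assms) auto
    qed
    also have "\<dots> = (\<Sum>k\<in>A. integral\<^sup>L M (\<lambda>\<omega>. (if k \<in> B then ?Z k \<omega> ^ card A else 1) / card A))"
      using powint by (rule Bochner_Integration.integral_sum)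
    also have "\<dots> = (\<Sum>k\<in>A. 1 / card A)"
    proof (intro sum.cong refl)
      fix k assume "k \<in> A"
      show "integral\<^sup>L M (\<lambda>\<omega>. (if k \<in> B then ?Z k \<omega> ^ card A else 1) / card A) = 1 / card A"
      proof (cases "k \<in> B")
        case True
        then have "n k \<noteq> 0"
          using apos[of k] aN[of k] by (metis less_irrefl zero_less_power)
        then show ?thesis
          using True by (simp add: power_divide aN n_def[symmetric])
      qed (simp add: prob_space)
    qed
    also have "\<dots> = 1"
      using N by simp
    finally have "\<bar>integral\<^sup>L M (\<lambda>\<omega>. \<Prod>k\<in>B. Y k \<omega>) / (\<Prod>k\<in>B. a k)\<bar> \<le> 1"
      by (simp add: prod_dividef)
    moreover have "0 < (\<Prod>k\<in>B. a k)"
      using apos by (intro prod_pos) auto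
    ultimately show ?thesis
      by (simp add: a_def n_def divide_le_eq)
  qed
qed

section \<open>Translation invariance of cumulants\<close>

lemma integrable_power_shift:
  fixes Y :: "'a \<Rightarrow> real"
  assumes "prob_space M" and [measurable]: "Y \<in> borel_measurable M"
    and "integrable M (\<lambda>\<omega>. \<bar>Y \<omega>\<bar> ^ n)"
  shows "integrable M (\<lambda>\<omega>. \<bar>Y \<omega> - c\<bar> ^ n)"
proof -
  interpret prob_space M by fact
  have le: "\<bar>x - c\<bar> ^ n \<le> 2 ^ n * (\<bar>x\<bar> ^ n + \<bar>c\<bar> ^ n)" for x
  proof -
    have "\<bar>x - c\<bar> ^ n \<le> (2 * max \<bar>x\<bar> \<bar>c\<bar>) ^ n"
      by (intro power_mono) auto
    also have "\<dots> = 2 ^ n * max \<bar>x\<bar> \<bar>c\<bar> ^ n"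
      by (rule power_mult_distrib)
    also have "\<dots> \<le> 2 ^ n * (\<bar>x\<bar> ^ n + \<bar>c\<bar> ^ n)"
      by (intro mult_left_mono) (auto simp: max_def)
    finally show ?thesis .
  qed
  show ?thesis
  proof (rule Bochner_Integration.integrable_bound)
    show "integrable M (\<lambda>\<omega>. 2 ^ n * (\<bar>Y \<omega>\<bar> ^ n + \<bar>c\<bar> ^ n))"
      using assms(3) by auto
  qed (use le in auto)
qed

text \<open>
  The variables are shifted one after another. Order at least two is essential: the cumulant of
  order one is the mean.
\<close>

lemma cumulant_translation_invariant:
  fixes Y :: "'i \<Rightarrow> 'a \<Rightarrow> real" and c :: "'i \<Rightarrow> real"
  assumes "prob_space M" "finite A" "card A \<ge> 2"
    and meas: "\<And>k. k \<in> A \<Longrightarrow> Y k \<in> borel_measurable M"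
    and int: "\<And>k. k \<in> A \<Longrightarrow> integrable M (\<lambda>\<omega>. \<bar>Y k \<omega>\<bar> ^ card A)"
  shows "cumulant_of_moments A (\<lambda>B. integral\<^sup>L M (\<lambda>\<omega>. \<Prod>k\<in>B. Y k \<omega> - c k)) =
         cumulant_of_moments A (\<lambda>B. integral\<^sup>L M (\<lambda>\<omega>. \<Prod>k\<in>B. Y k \<omega>))"
proof -
  interpret prob_space M by fact
  define Z where "Z T k \<omega> = Y k \<omega> - (if k \<in> T then c k else 0)" for T k \<omega>
  define m where "m T B = integral\<^sup>L M (\<lambda>\<omega>. \<Prod>k\<in>B. Z T k \<omega>)" for T B
  have "A \<noteq> {}"
    using assms(3) by auto
  have int_prod: "integrable M (\<lambda>\<omega>. \<Prod>k\<in>B. Z T k \<omega>)" if "B \<subseteq> A" for T B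
  proof (rule integrable_prod_of_integrable_power[OF assms(1,2) \<open>A \<noteq> {}\<close> that])
    fix k assume k: "k \<in> A"
    note [measurable] = meas[OF k]
    show "Z T k \<in> borel_measurable M"
      unfolding Z_def by measurable
    show "integrable M (\<lambda>\<omega>. \<bar>Z T k \<omega>\<bar> ^ card A)"
      unfolding Z_def by (rule integrable_power_shift[OF assms(1) meas[OF k] int[OF k]])
  qed
  have "cumulant_of_moments A (m T) = cumulant_of_moments A (m {})" if "T \<subseteq> A" for T
    using finite_subset[OF that assms(2)] that
  proof (induction T rule: finite_induct)
    case empty
    show ?case by simp
  next
    case (insert i T)
    have "m (insert i T) B = (if i \<in> B then m T B - c i * m T (B - {i}) else m T B)"
      if B: "B \<subseteq> A" for B
    proof (cases "i \<in> B")
      case True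
      have fin: "finite B"
        using B assms(2) finite_subset by blast
      have split: "(\<Prod>k\<in>B. Z S k \<omega>) = Z S i \<omega> * (\<Prod>k\<in>B - {i}. Z S k \<omega>)" for S \<omega>
        using fin True by (rule prod.remove)
      have "(\<Prod>k\<in>B - {i}. Z (insert i T) k \<omega>) = (\<Prod>k\<in>B - {i}. Z T k \<omega>)" for \<omega>
        by (intro prod.cong) (auto simp: Z_def)
      moreover have "Z (insert i T) i \<omega> = Z T i \<omega> - c i" for \<omega>
        using insert by (simp add: Z_def)
      ultimately have "(\<Prod>k\<in>B. Z (insert i T) k \<omega>) =
          (\<Prod>k\<in>B. Z T k \<omega>) - c i * (\<Prod>k\<in>B - {i}. Z T k \<omega>)" for \<omega>
        by (simp add: split left_diff_distrib)
      then show ?thesis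
        using True int_prod[of B T] int_prod[of "B - {i}" T] B
        by (simp add: m_def subset_iff)
    next
      case False
      then have "(\<Prod>k\<in>B. Z (insert i T) k \<omega>) = (\<Prod>k\<in>B. Z T k \<omega>)" for \<omega>
        by (intro prod.cong) (auto simp: Z_def)
      then show ?thesis
        using False by (simp add: m_def)
    qed
    then have "cumulant_of_moments A (m (insert i T)) =
        cumulant_of_moments A (\<lambda>B. if i \<in> B then m T B - c i * m T (B - {i}) else m T B)"
      by (rule cumulant_of_moments_cong)
    also have "\<dots> = cumulant_of_moments A (m T)"
    proof (rule cumulant_of_moments_shift[OF assms(2)])
      show "A \<noteq> {i}" using assms(3) by auto
      show "m T {} = 1" by (simp add: m_def prob_space)
    qed (use insert in auto)
    finally show ?case
      using insert by simp
  qed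
  from this[of A] have "cumulant_of_moments A (m A) = cumulant_of_moments A (m {})"
    by simp
  moreover have "cumulant_of_moments A (m A) =
      cumulant_of_moments A (\<lambda>B. integral\<^sup>L M (\<lambda>\<omega>. \<Prod>k\<in>B. Y k \<omega> - c k))"
  proof (rule cumulant_of_moments_cong)
    fix B assume "B \<subseteq> A"
    then have "(\<Prod>k\<in>B. Z A k \<omega>) = (\<Prod>k\<in>B. Y k \<omega> - c k)" for \<omega>
      by (intro prod.cong) (auto simp: Z_def)
    then show "m A B = integral\<^sup>L M (\<lambda>\<omega>. \<Prod>k\<in>B. Y k \<omega> - c k)"
      by (simp add: m_def)
  qed
  moreover have "m {} = (\<lambda>B. integral\<^sup>L M (\<lambda>\<omega>. \<Prod>k\<in>B. Y k \<omega>))"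
    by (rule ext) (simp add: m_def Z_def)
  ultimately show ?thesis
    by simp
qed

section \<open>Moments of a random vector\<close>

text \<open>
  Replacing \<open>X\<close> by \<open>-X\<close> keeps the moment, by symmetry, and multiplies it by \<open>(-1) ^ card B\<close>.
\<close>

lemma odd_moment_of_symmetric_vector_eq_0:
  fixes X :: "'a \<Rightarrow> real ^ 'd::finite"
  assumes X: "X \<in> borel_measurable M"
    and sym: "distr M borel X = distr M borel (\<lambda>\<omega>. - X \<omega>)"
    and "odd (card B)"
  shows "integral\<^sup>L M (\<lambda>\<omega>. \<Prod>k\<in>B. X \<omega> $ \<sigma> k) = 0"
proof -
  let ?f = "\<lambda>x::real ^ 'd. \<Prod>k\<in>B. x $ \<sigma> k"
  have f: "?f \<in> borel_measurable borel"
    by (intro borel_measurable_continuous_onI continuous_intros)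
  have "integral\<^sup>L M (\<lambda>\<omega>. ?f (X \<omega>)) = integral\<^sup>L (distr M borel X) ?f"
    using X f by (simp add: integral_distr)
  also have "\<dots> = integral\<^sup>L (distr M borel (\<lambda>\<omega>. - X \<omega>)) ?f"
    by (simp only: sym)
  also have "\<dots> = integral\<^sup>L M (\<lambda>\<omega>. ?f (- X \<omega>))"
    using X f by (intro integral_distr) auto
  also have "\<dots> = integral\<^sup>L M (\<lambda>\<omega>. - ?f (X \<omega>))"
    using \<open>odd (card B)\<close> by (simp add: prod_uminus)
  finally show ?thesis by simp
qed

text \<open>
  Grouping the positions by label turns the product of norms into the right-hand side of the bounds.
  For \<open>\<nu> j = 0\<close> there is no position with label \<open>j\<close>, which is where \<open>rpow\<close> and its convention
  for the exponent 0 are needed.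
\<close>

lemma prod_powr_index_map:
  fixes n :: "'d::finite \<Rightarrow> real"
  assumes "index_map \<nu> \<sigma>" and "\<And>j. 0 \<le> n j" and N: "N = multi_order \<nu>" "N \<ge> 1"
  shows "(\<Prod>k\<in>{1..N}. n (\<sigma> k) powr (1 / real N)) = (\<Prod>j\<in>UNIV. rpow (n j) (real (\<nu> j) / real N))"
proof -
  have "(\<Prod>k\<in>{1..N}. n (\<sigma> k) powr (1 / real N)) =
      (\<Prod>j\<in>UNIV. \<Prod>k\<in>{k \<in> {1..N}. \<sigma> k = j}. n (\<sigma> k) powr (1 / real N))"
    by (rule prod.group[symmetric]) auto
  also have "\<dots> = (\<Prod>j\<in>UNIV. (n j powr (1 / real N)) ^ \<nu> j)"
  proof (intro prod.cong refl)
    fix j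
    have "(\<Prod>k\<in>{k \<in> {1..N}. \<sigma> k = j}. n (\<sigma> k) powr (1 / real N)) =
        (\<Prod>k\<in>{k \<in> {1..N}. \<sigma> k = j}. n j powr (1 / real N))"
      by (intro prod.cong) auto
    then show "(\<Prod>k\<in>{k \<in> {1..N}. \<sigma> k = j}. n (\<sigma> k) powr (1 / real N)) =
        (n j powr (1 / real N)) ^ \<nu> j"
      using assms(1) by (simp add: index_map_def N(1))
  qed
  also have "\<dots> = (\<Prod>j\<in>UNIV. rpow (n j) (real (\<nu> j) / real N))"
  proof (intro prod.cong refl)
    fix j
    show "(n j powr (1 / real N)) ^ \<nu> j = rpow (n j) (real (\<nu> j) / real N)"
      using N(2) by (cases "n j = 0") (auto simp: rpow_def powr_power)
  qed
  finally show ?thesis .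
qed

lemma joint_cumulant_eq_cumulant_of_moments:
  "joint_cumulant M \<nu> \<sigma> X = cumulant_of_moments {1..multi_order \<nu>}
     (\<lambda>B. integral\<^sup>L M (\<lambda>\<omega>. \<Prod>k\<in>B. X \<omega> $ \<sigma> k))"
  by (simp add: joint_cumulant_def cumulant_of_moments_def set_partitions_def)

theorem theorem6p4:
  fixes M :: "'a measure"
    and X :: "'a \<Rightarrow> real ^ 'd::finite"
    and \<nu> :: "'d \<Rightarrow> nat"
    and \<sigma> :: "nat \<Rightarrow> 'd"
    and N :: nat
  assumes "prob_space M"
    and "X \<in> borel_measurable M"
    and "N = multi_order \<nu>"
    and "N \<ge> 1"
    and "index_map \<nu> \<sigma>"
    and "\<And>j. integrable M (\<lambda>\<omega>. \<bar>X \<omega> $ j\<bar> ^ N)"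
  shows
    "\<bar>joint_cumulant M \<nu> \<sigma> X\<bar> \<le>
       C_raw N * (\<Prod>j\<in>UNIV. rpow (prob_space.expectation M (\<lambda>\<omega>. \<bar>X \<omega> $ j\<bar> ^ N))
                                   (real (\<nu> j) / real N))
     \<and> (N \<ge> 2 \<longrightarrow>
         \<bar>joint_cumulant M \<nu> \<sigma> X\<bar> \<le>
         C_cen N * (\<Prod>j\<in>UNIV.
           rpow (prob_space.expectation M
                   (\<lambda>\<omega>. \<bar>X \<omega> $ j - prob_space.expectation M (\<lambda>\<omega>'. X \<omega>' $ j)\<bar> ^ N))
                (real (\<nu> j) / real N)))
     \<and> (distr M borel X = distr M borel (\<lambda>\<omega>. - X \<omega>) \<longrightarrow>
         (odd N \<longrightarrow> joint_cumulant M \<nu> \<sigma> X = 0) \<and>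
         (even N \<longrightarrow>
           \<bar>joint_cumulant M \<nu> \<sigma> X\<bar> \<le>
           C_sym N * (\<Prod>j\<in>UNIV. rpow (prob_space.expectation M (\<lambda>\<omega>. \<bar>X \<omega> $ j\<bar> ^ N))
                                       (real (\<nu> j) / real N))))"
proof -
  interpret prob_space M by fact
  note N = assms(3) and N1 = assms(4)
  let ?A = "{1..N}"
  let ?m = "\<lambda>B. expectation (\<lambda>\<omega>. \<Prod>k\<in>B. X \<omega> $ \<sigma> k)"
  let ?\<mu> = "\<lambda>j. expectation (\<lambda>\<omega>. X \<omega> $ j)"
  let ?raw = "\<lambda>j. expectation (\<lambda>\<omega>. \<bar>X \<omega> $ j\<bar> ^ N)"
  let ?cen = "\<lambda>j. expectation (\<lambda>\<omega>. \<bar>X \<omega> $ j - ?\<mu> j\<bar> ^ N)"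
  have A: "finite ?A" "?A \<noteq> {}" "card ?A = N"
    using N1 by auto
  have meas: "(\<lambda>\<omega>. X \<omega> $ j) \<in> borel_measurable M" for j
    by (rule measurable_compose[OF assms(2)])
      (intro borel_measurable_continuous_onI continuous_intros)
  have int: "integrable M (\<lambda>\<omega>. \<bar>X \<omega> $ j\<bar> ^ N)" for j
    by fact
  have \<kappa>: "joint_cumulant M \<nu> \<sigma> X = cumulant_of_moments ?A ?m"
    unfolding N by (rule joint_cumulant_eq_cumulant_of_moments)
  have raw: "(\<Prod>k\<in>?A. ?raw (\<sigma> k) powr (1 / real N)) =
      (\<Prod>j\<in>UNIV. rpow (?raw j) (real (\<nu> j) / real N))"
    by (rule prod_powr_index_map[OF assms(5) _ N N1]) simp
  have cen: "(\<Prod>k\<in>?A. ?cen (\<sigma> k) powr (1 / real N)) =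
      (\<Prod>j\<in>UNIV. rpow (?cen j) (real (\<nu> j) / real N))"
    by (rule prod_powr_index_map[OF assms(5) _ N N1]) simp
  have bound: "\<bar>?m B\<bar> \<le> (\<Prod>k\<in>B. ?raw (\<sigma> k) powr (1 / real N))" if "B \<subseteq> ?A" for B
    using Hoelder_mixed_moment[OF assms(1) A(1,2) that, of "\<lambda>k \<omega>. X \<omega> $ \<sigma> k"] meas int
    unfolding A(3) by blast

  have "\<bar>joint_cumulant M \<nu> \<sigma> X\<bar> \<le> C_raw N * (\<Prod>j\<in>UNIV. rpow (?raw j) (real (\<nu> j) / real N))"
    using abs_cumulant_of_moments_le[OF A(1) bound, of "\<lambda>_. True"]
    unfolding \<kappa> raw[symmetric] C_raw_def set_partitions_def by simp

  moreover have "\<bar>joint_cumulant M \<nu> \<sigma> X\<bar> \<le>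
      C_cen N * (\<Prod>j\<in>UNIV. rpow (?cen j) (real (\<nu> j) / real N))" if N2: "N \<ge> 2"
  proof -
    let ?c = "\<lambda>B. expectation (\<lambda>\<omega>. \<Prod>k\<in>B. X \<omega> $ \<sigma> k - ?\<mu> (\<sigma> k))"
    have "joint_cumulant M \<nu> \<sigma> X = cumulant_of_moments ?A ?c"
      unfolding \<kappa>
      using cumulant_translation_invariant[OF assms(1) A(1), of "\<lambda>k \<omega>. X \<omega> $ \<sigma> k" "\<lambda>k. ?\<mu> (\<sigma> k)"]
        meas int N2 unfolding A(3) by simp
    moreover have "\<bar>?c B\<bar> \<le> (\<Prod>k\<in>B. ?cen (\<sigma> k) powr (1 / real N))" if "B \<subseteq> ?A" for B
    proof -
      have "integrable M (\<lambda>\<omega>. \<bar>X \<omega> $ \<sigma> k - ?\<mu> (\<sigma> k)\<bar> ^ N)" for k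
        by (rule integrable_power_shift[OF assms(1) meas int])
      moreover have "(\<lambda>\<omega>. X \<omega> $ \<sigma> k - ?\<mu> (\<sigma> k)) \<in> borel_measurable M" for k
        by (intro borel_measurable_diff meas) simp
      ultimately show ?thesis
        using Hoelder_mixed_moment[OF assms(1) A(1,2) that, of "\<lambda>k \<omega>. X \<omega> $ \<sigma> k - ?\<mu> (\<sigma> k)"]
        unfolding A(3) by blast
    qed
    moreover have "?c B = 0" if B: "B \<subseteq> ?A" "B \<noteq> {}" "\<not> card B \<ge> 2" for B
    proof -
      have "finite B"
        using B(1) finite_subset by blast
      then have "card B = 1"
        using B by (metis One_nat_def Suc_1 card_gt_0_iff le_antisym not_less_eq_eq Suc_leI)
      then obtain k where k: "B = {k}"
        by (rule card_1_singletonE)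
      have "k \<in> ?A" using B(1) k by blast
      then have "integrable M (\<lambda>\<omega>. X \<omega> $ \<sigma> k)"
        using integrable_prod_of_integrable_power[OF assms(1) A(1,2), of "{k}" "\<lambda>k \<omega>. X \<omega> $ \<sigma> k"]
          meas int unfolding A(3) by simp
      then show ?thesis
        by (simp add: k prob_space)
    qed
    ultimately show ?thesis
      using abs_cumulant_of_moments_le[OF A(1), of ?c "\<lambda>k. ?cen (\<sigma> k) powr (1 / real N)" "\<lambda>B. card B \<ge> 2"]
      unfolding cen[symmetric] C_cen_def set_partitions_def by simp
  qed

  moreover have "(odd N \<longrightarrow> joint_cumulant M \<nu> \<sigma> X = 0) \<and> (even N \<longrightarrow>
      \<bar>joint_cumulant M \<nu> \<sigma> X\<bar> \<le> C_sym N * (\<Prod>j\<in>UNIV. rpow (?raw j) (real (\<nu> j) / real N)))"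
    if sym: "distr M borel X = distr M borel (\<lambda>\<omega>. - X \<omega>)"
  proof -
    have "?m B = 0" if "\<not> even (card B)" for B
      by (rule odd_moment_of_symmetric_vector_eq_0[OF assms(2) sym that])
    then have le: "\<bar>joint_cumulant M \<nu> \<sigma> X\<bar> \<le>
        C_sym N * (\<Prod>j\<in>UNIV. rpow (?raw j) (real (\<nu> j) / real N))"
      using abs_cumulant_of_moments_le[OF A(1) bound, of "\<lambda>B. even (card B)"]
      unfolding \<kappa> raw[symmetric] C_sym_def set_partitions_def by simp
    have "C_sym N = 0" if "odd N"
    proof -
      have "\<not> (\<forall>B\<in>\<pi>. even (card B))" if "partition_on ?A \<pi>" for \<pi>
      proof
        assume "\<forall>B\<in>\<pi>. even (card B)"
        moreover have "N = (\<Sum>B\<in>\<pi>. card B)"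
          using sum.partition[OF A(1) that, of "\<lambda>_. 1::nat"] A(3) by simp
        ultimately show False
          using \<open>odd N\<close> by (metis dvd_sum)
      qed
      then have "{\<pi> \<in> set_partitions N. \<forall>B\<in>\<pi>. even (card B)} = {}"
        by (auto simp: set_partitions_def)
      then show ?thesis
        unfolding C_sym_def by (metis sum.empty)
    qed
    then show ?thesis
      using le by auto
  qed
  ultimately show ?thesis
    by blast
qed

end
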